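(* No countable intersection of tall analytic $P$-ideals on $\omega$ has the Ramsey property, and no countable intersection of ideals on $\omega$ each failing the ordinary Ramsey property has the Ramsey property; in particular, no countable intersection of topologically represented ideals has the Ramsey property.
   Context: All ideals on $\omega$ are proper and contain all finite sets; they are viewed as subsets of $2^\omega\cong\mathcal P(\omega)$, so "analytic" makes sense. $\mathcal I^+=\mathcal P(\omega)\setminus\mathcal I$. An ideal is tall if every infinite subset of $\omega$ has an infinite subset in the ideal. It is a $P$-ideal if for every sequence $(A_n)$ of its members there is a member $A$ with $A_n\setminus A$ finite for all $n$. $\mathcal I$ has the Ramsey property if for every $X\in\mathcal I^+$ and every $c:[X]^2\to2$ there is $Y\subseteq X$, $Y\in\mathcal I^+$, with $c\upharpoonright[Y]^2$ constant. $\mathcal I$ has the ordinary Ramsey property if this holds for $X=\omega$ only. An ideal $\mathcal J$ on $\omega$ is topologically represented if there are a compact metric space $K$, a dense $D\subseteq K$, a bijection $e:\omega\to D$ and a $\sigma$-ideal $\mathscr K$ of compact sets (compact subsets of $K$) such that for all $A\subseteq\omega$: $A\in\mathcal J\iff\overline{e[A]}\in\mathscr K$.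
   Formalization: The σ-ideal of compact sets in "topologically represented" is required to contain all singletons of K; without this, the finite subsets of ω in K = ω+1 represent the ideal of finite sets, which has the Ramsey property. The countable family intersected is nonempty. *)

theory Defs
  imports "HOL-Analysis.Analysis" "HOL-Library.Ramsey"
begin

definition omega_ideal :: "nat set set \<Rightarrow> bool" where
  "omega_ideal I \<longleftrightarrow>
     (\<forall>A. finite A \<longrightarrow> A \<in> I) \<and>
     (\<forall>A\<in>I. \<forall>B. B \<subseteq> A \<longrightarrow> B \<in> I) \<and>
     (\<forall>A\<in>I. \<forall>B\<in>I. A \<union> B \<in> I) \<and>
     UNIV \<notin> I"

definition tall :: "nat set set \<Rightarrow> bool" where
  "tall I \<longleftrightarrow> (\<forall>A. infinite A \<longrightarrow> (\<exists>B\<subseteq>A. infinite B \<and> B \<in> I))"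

definition p_ideal :: "nat set set \<Rightarrow> bool" where
  "p_ideal I \<longleftrightarrow> omega_ideal I \<and>
     (\<forall>A :: nat \<Rightarrow> nat set. (\<forall>n. A n \<in> I) \<longrightarrow> (\<exists>B\<in>I. \<forall>n. finite (A n - B)))"

text \<open>
  The type \<open>nat \<Rightarrow> nat\<close> carries the product of discrete topologies, so it is the Baire space.
\<close>

definition analytic_set :: "'a::topological_space set \<Rightarrow> bool" where
  "analytic_set S \<longleftrightarrow>
     S = {} \<or> (\<exists>f :: (nat \<Rightarrow> nat) \<Rightarrow> 'a. continuous_on UNIV f \<and> S = range f)"

text \<open>
  A family of sets of naturals is viewed, through characteristic functions, as a subset
  of \<open>nat \<Rightarrow> bool\<close>, which carries the product topology of the Cantor space.
\<close>

definition analytic_family :: "nat set set \<Rightarrow> bool" where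
  "analytic_family I \<longleftrightarrow> analytic_set ((\<lambda>A n. n \<in> A) ` I)"

definition ramsey_at :: "nat set set \<Rightarrow> nat set \<Rightarrow> bool" where
  "ramsey_at I X \<longleftrightarrow>
     (\<forall>c :: nat set \<Rightarrow> nat. c \<in> nsets X 2 \<rightarrow> {0, 1} \<longrightarrow>
        (\<exists>Y. Y \<subseteq> X \<and> Y \<notin> I \<and> c constant_on nsets Y 2))"

definition ramsey_property :: "nat set set \<Rightarrow> bool" where
  "ramsey_property I \<longleftrightarrow> (\<forall>X. X \<notin> I \<longrightarrow> ramsey_at I X)"

definition ordinary_ramsey_property :: "nat set set \<Rightarrow> bool" where
  "ordinary_ramsey_property I \<longleftrightarrow> ramsey_at I UNIV"

text \<open>
  A \<open>\<sigma>\<close>-ideal of compact sets is closed under compact subsets and under those countable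
  unions that are compact. As usual for ideals of subsets of a space, it contains all
  singletons. Without this the finite subsets of \<open>\<omega>\<close> inside \<open>\<omega> + 1\<close> would qualify, and would
  represent the ideal of finite sets, which has the Ramsey property.
\<close>

definition sigma_ideal_of_compacts :: "'a topology \<Rightarrow> 'a set set \<Rightarrow> bool" where
  "sigma_ideal_of_compacts T \<K> \<longleftrightarrow>
     (\<forall>C\<in>\<K>. compactin T C) \<and>
     (\<forall>x\<in>topspace T. {x} \<in> \<K>) \<and>
     (\<forall>C\<in>\<K>. \<forall>C'. compactin T C' \<and> C' \<subseteq> C \<longrightarrow> C' \<in> \<K>) \<and>
     (\<forall>C :: nat \<Rightarrow> 'a set. (\<forall>n. C n \<in> \<K>) \<and> compactin T (\<Union>n. C n) \<longrightarrow> (\<Union>n. C n) \<in> \<K>)"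

definition represents ::
  "'a metric \<Rightarrow> 'a set \<Rightarrow> (nat \<Rightarrow> 'a) \<Rightarrow> 'a set set \<Rightarrow> nat set set \<Rightarrow> bool" where
  "represents K D e \<K> J \<longleftrightarrow>
     compact_space (mtopology_of K) \<and>
     D \<subseteq> mspace K \<and> mtopology_of K closure_of D = mspace K \<and>
     bij_betw e UNIV D \<and>
     sigma_ideal_of_compacts (mtopology_of K) \<K> \<and>
     (\<forall>A. A \<in> J \<longleftrightarrow> mtopology_of K closure_of (e ` A) \<in> \<K>)"

text \<open>
  A definition cannot quantify over types. Taking the points of the compact metric space to be
  reals loses nothing, since such a space has at most continuum many points. The metric is an
  arbitrary one on an arbitrary set of reals, unrelated to the usual distance. The theorem
  \<open>represents_imp_topologically_represented\<close> below confirms that every other type of points is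
  covered.
\<close>

definition topologically_represented :: "nat set set \<Rightarrow> bool" where
  "topologically_represented J \<longleftrightarrow> (\<exists>(K :: real metric) D e \<K>. represents K D e \<K> J)"

lemma separable_metric_inj_real:
  fixes K :: "'a metric" and e :: "nat \<Rightarrow> 'a"
  assumes e: "range e \<subseteq> mspace K" and dense: "mtopology_of K closure_of (range e) = mspace K"
  shows "\<exists>g :: 'a \<Rightarrow> real. inj_on g (mspace K)"
proof -
  define h where "h x = {p. mdist K x (e (fst p)) < inverse (Suc (snd p))}" for x
  have inj_h: "inj_on h (mspace K)"
  proof (rule inj_onI, rule ccontr)
    fix x y assume x: "x \<in> mspace K" and y: "y \<in> mspace K" and eq: "h x = h y" and ne: "x \<noteq> y"
    have pos: "mdist K x y > 0" using x y ne by (simp add: order.not_eq_order_implies_strict)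
    obtain k where k: "inverse (real (Suc k)) < mdist K x y / 2"
      using pos reals_Archimedean[of "mdist K x y / 2"] by auto
    have "x \<in> mtopology_of K closure_of (range e)" using x dense by simp
    then have "\<forall>r>0. \<exists>y\<in>range e. y \<in> Metric_space.mball (mspace K) (mdist K) x r"
      unfolding mtopology_of_def Metric_space.metric_closure_of[OF Metric_space_mspace_mdist]
      by simp
    then obtain y' where "y' \<in> range e"
      "y' \<in> Metric_space.mball (mspace K) (mdist K) x (inverse (real (Suc k)))"
      by (meson inverse_positive_iff_positive of_nat_0_less_iff zero_less_Suc)
    then obtain n where n: "mdist K x (e n) < inverse (real (Suc k))"
      unfolding Metric_space.in_mball[OF Metric_space_mspace_mdist] by blast
    then have "(n, k) \<in> h x" by (simp add: h_def)
    then have "(n, k) \<in> h y" using eq by simp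
    then have "mdist K y (e n) < inverse (real (Suc k))" by (simp add: h_def)
    moreover have "mdist K x y \<le> mdist K x (e n) + mdist K (e n) y"
      using mdist_triangle x y e by (metis rangeI subsetD)
    ultimately show False using n k by (simp add: mdist_commute)
  qed
  have inj_enc: "inj (image prod_encode)"
    by (rule injI) (simp add: inj_image_eq_iff inj_prod_encode)
  obtain r :: "nat set \<Rightarrow> real" where r: "inj r"
    using nat_sets_eqpoll_reals by (auto simp: eqpoll_def bij_betw_def)
  have "inj_on (\<lambda>x. r (prod_encode ` h x)) (mspace K)"
    using inj_h r inj_enc by (auto simp: inj_on_def)
  then show ?thesis by blast
qed

theorem represents_imp_topologically_represented:
  fixes K :: "'a metric"
  assumes rep: "represents K D e \<K> J"
  shows "topologically_represented J"
proof -
  have De: "D = range e" and inje: "inj e" using rep by (auto simp: represents_def bij_betw_def)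
  obtain g :: "'a \<Rightarrow> real" where g: "inj_on g (mspace K)"
    using separable_metric_inj_real[of e K] rep De by (auto simp: represents_def)
  define h where "h = inv_into (mspace K) g"
  have hg: "h (g x) = x" if "x \<in> mspace K" for x using that g by (simp add: h_def)
  define K' where "K' = metric (g ` mspace K, \<lambda>u v. mdist K (h u) (h v))"
  have "Metric_space (g ` mspace K) (\<lambda>u v. mdist K (h u) (h v))"
    by unfold_locales (auto simp: hg mdist_commute intro: mdist_triangle)
  then have ms: "mspace K' = g ` mspace K" and md: "mdist K' = (\<lambda>u v. mdist K (h u) (h v))"
    by (simp_all add: K'_def Metric_space.mspace_metric Metric_space.mdist_metric)
  let ?T = "mtopology_of K" and ?T' = "mtopology_of K'"
  have cg: "continuous_map ?T ?T' g"
    unfolding mtopology_of_def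
      Metric_space.metric_continuous_map[OF Metric_space_mspace_mdist Metric_space_mspace_mdist]
    using ms md hg by fastforce
  have ch: "continuous_map ?T' ?T h"
    unfolding mtopology_of_def
      Metric_space.metric_continuous_map[OF Metric_space_mspace_mdist Metric_space_mspace_mdist]
    unfolding ms md using hg by (auto simp del: mdist_zero)
  have hom: "homeomorphic_map ?T ?T' g"
    unfolding homeomorphic_map_maps homeomorphic_maps_def using cg ch hg ms by auto
  define \<K>' where "\<K>' = image g ` \<K>"
  have sK: "sigma_ideal_of_compacts ?T \<K>" using rep by (simp add: represents_def)
  have sU: "(\<Union>n. C n) \<in> \<K>" if "\<forall>n. C n \<in> \<K>" "compactin ?T (\<Union>n. C n)"
    for C :: "nat \<Rightarrow> 'a set"
    using sK that by (simp add: sigma_ideal_of_compacts_def)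
  have sub: "C \<subseteq> mspace K" if "C \<in> \<K>" for C
    using sK that compactin_subset_topspace by (fastforce simp: sigma_ideal_of_compacts_def)
  have hgi: "h ` g ` C = C" if "C \<subseteq> mspace K" for C
    using that hg by (force simp: image_image)
  have ghi: "g ` h ` C = C" if "C \<subseteq> mspace K'" for C
    using that hg ms by (force simp: image_image)
  have mem: "C \<in> \<K>' \<longleftrightarrow> h ` C \<in> \<K>" if "C \<subseteq> mspace K'" for C
    using that hgi ghi sub unfolding \<K>'_def by (metis (no_types, lifting) image_iff)
  have sub': "C \<subseteq> mspace K'" if "C \<in> \<K>'" for C
    using that sub ms unfolding \<K>'_def by auto
  have comp: "compactin ?T' C \<Longrightarrow> compactin ?T (h ` C)" for C
    using ch image_compactin by blast
  have "sigma_ideal_of_compacts ?T' \<K>'"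
    unfolding sigma_ideal_of_compacts_def
  proof (intro conjI ballI allI impI)
    fix C assume "C \<in> \<K>'"
    then show "compactin ?T' C"
      using sK cg image_compactin unfolding \<K>'_def sigma_ideal_of_compacts_def by blast
  next
    fix x assume "x \<in> topspace ?T'"
    then obtain y where y: "y \<in> topspace ?T" "x = g y" using ms by auto
    then have "{y} \<in> \<K>" using sK unfolding sigma_ideal_of_compacts_def by blast
    then have "g ` {y} \<in> \<K>'" unfolding \<K>'_def by (rule imageI)
    then show "{x} \<in> \<K>'" using y by simp
  next
    fix C C' assume C: "C \<in> \<K>'" and C': "compactin ?T' C' \<and> C' \<subseteq> C"
    have "h ` C \<in> \<K>" using C mem sub' by blast
    moreover have "h ` C' \<subseteq> h ` C" "compactin ?T (h ` C')" using C' comp by auto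
    ultimately have "h ` C' \<in> \<K>" using sK unfolding sigma_ideal_of_compacts_def by blast
    then show "C' \<in> \<K>'" using mem sub' C C' by blast
  next
    fix C :: "nat \<Rightarrow> real set" assume C: "(\<forall>n. C n \<in> \<K>') \<and> compactin ?T' (\<Union>n. C n)"
    have "\<forall>n. h ` C n \<in> \<K>" using C mem sub' by blast
    moreover have "compactin ?T (\<Union>n. h ` C n)" using C comp[of "\<Union>n. C n"] by (simp add: image_UN)
    ultimately have "(\<Union>n. h ` C n) \<in> \<K>" by (rule sU)
    then have "h ` (\<Union>n. C n) \<in> \<K>" by (simp add: image_UN)
    then show "(\<Union>n. C n) \<in> \<K>'" using mem[of "\<Union>n. C n"] sub' C by blast
  qed
  moreover have "compact_space ?T'"
    using rep homeomorphic_compact_space[OF homeomorphic_map_imp_homeomorphic_space[OF hom]]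
    by (simp add: represents_def)
  moreover have cl: "?T' closure_of (g ` S) = g ` (?T closure_of S)" if "S \<subseteq> mspace K" for S
    using homeomorphic_map_closure_of[OF hom, of S] that by simp
  moreover have DK: "D \<subseteq> mspace K" and dense: "?T closure_of D = mspace K"
    using rep by (auto simp: represents_def)
  moreover have "bij_betw (g \<circ> e) UNIV (g ` D)"
    using bij_betw_trans[of e UNIV D g "g ` D"] inj_on_imp_bij_betw[OF inj_on_subset[OF g DK]] rep
    by (simp add: represents_def)
  moreover have "A \<in> J \<longleftrightarrow> ?T' closure_of ((g \<circ> e) ` A) \<in> \<K>'" for A
  proof -
    have eA: "e ` A \<subseteq> mspace K" using De DK by auto
    have c: "?T closure_of (e ` A) \<subseteq> mspace K" using closure_of_subset_topspace by fastforce
    have "?T' closure_of ((g \<circ> e) ` A) = g ` (?T closure_of (e ` A))"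
      using cl[OF eA] by (simp add: image_comp)
    moreover have "g ` (?T closure_of (e ` A)) \<in> \<K>' \<longleftrightarrow> ?T closure_of (e ` A) \<in> \<K>"
      using mem[of "g ` (?T closure_of (e ` A))"] hgi[OF c] c ms by auto
    ultimately show ?thesis using rep by (simp add: represents_def)
  qed
  ultimately have "represents K' (g ` D) (g \<circ> e) \<K>' J"
    using ms by (simp add: represents_def image_mono)
  then show ?thesis unfolding topologically_represented_def by blast
qed

end

theory Submission
  imports Defs
begin

text \<open>
  All three claims reduce to the second one. Suppose that \<open>\<Inter>F\<close> has the Ramsey property, and let
  \<open>c\<^sub>n\<close> witness that the \<open>n\<close>-th member of \<open>F\<close> fails the ordinary one. Applied to Sierpinski's
  colouring, the Ramsey property yields, for any sequence of sets, a positive set that none of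
  them splits. Two such steps give a positive \<open>Z\<close> on which every iterated limit
  \<open>lim\<^sub>x lim\<^sub>y c\<^sub>n(x, y)\<close> exists. A last colouring thins \<open>Z\<close> out to a positive set that is, up to
  a finite set, \<open>c\<^sub>n\<close>-homogeneous for all \<open>n\<close>, hence lies in every member of \<open>F\<close>.

  For a topologically represented ideal, Sierpinski's colouring for a countable base has only
  homogeneous sets whose closure is a convergent sequence with its limit. A tall analytic
  P-ideal is handled by an unfolded game with open payoff: a winning strategy turns every
  sufficiently sparse set into a member of the ideal, and sparseness is decided by pairs.
\<close>

section \<open>Ideals and homogeneous sets\<close>

lemma omega_ideal_subset: "omega_ideal I \<Longrightarrow> A \<in> I \<Longrightarrow> B \<subseteq> A \<Longrightarrow> B \<in> I"
  unfolding omega_ideal_def by blast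

lemma omega_ideal_Un: "omega_ideal I \<Longrightarrow> A \<in> I \<Longrightarrow> B \<in> I \<Longrightarrow> A \<union> B \<in> I"
  unfolding omega_ideal_def by blast

text \<open>A colouring of pairs is a predicate read only at increasing arguments, so it may treat
  the smaller and the larger element differently.\<close>

definition homog :: "(nat \<Rightarrow> nat \<Rightarrow> bool) \<Rightarrow> nat set \<Rightarrow> bool" where
  "homog P Y \<longleftrightarrow> (\<exists>b. \<forall>x\<in>Y. \<forall>y\<in>Y. x < y \<longrightarrow> P x y = b)"

lemma ramsey_at_iff_homog:
  "ramsey_at I X \<longleftrightarrow> (\<forall>P. \<exists>Y\<subseteq>X. Y \<notin> I \<and> homog P Y)"
proof
  assume R: "ramsey_at I X"
  show "\<forall>P. \<exists>Y\<subseteq>X. Y \<notin> I \<and> homog P Y"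
  proof
    fix P :: "nat \<Rightarrow> nat \<Rightarrow> bool"
    define c :: "nat set \<Rightarrow> nat" where "c S = (if P (Min S) (Max S) then 1 else 0)" for S
    have "c \<in> nsets X 2 \<rightarrow> {0, 1}" by (simp add: c_def)
    then obtain Y v where Y: "Y \<subseteq> X" "Y \<notin> I" and v: "\<forall>S\<in>nsets Y 2. c S = v"
      using R unfolding ramsey_at_def constant_on_def by blast
    have "P x y = (v = 1)" if "x \<in> Y" "y \<in> Y" "x < y" for x y
    proof -
      have "{x, y} \<in> nsets Y 2" using that by (simp add: nsets_def)
      then have "c {x, y} = v" using v by blast
      then show ?thesis using that by (auto simp: c_def split: if_splits)
    qed
    then show "\<exists>Y\<subseteq>X. Y \<notin> I \<and> homog P Y" using Y unfolding homog_def by blast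
  qed
next
  assume R: "\<forall>P. \<exists>Y\<subseteq>X. Y \<notin> I \<and> homog P Y"
  show "ramsey_at I X"
    unfolding ramsey_at_def
  proof (intro allI impI)
    fix c :: "nat set \<Rightarrow> nat" assume c: "c \<in> nsets X 2 \<rightarrow> {0, 1}"
    obtain Y b where Y: "Y \<subseteq> X" "Y \<notin> I"
      and b: "\<forall>x\<in>Y. \<forall>y\<in>Y. x < y \<longrightarrow> (c {x, y} = 1) = b"
      using R[rule_format, of "\<lambda>x y. c {x, y} = 1"] unfolding homog_def by blast
    have "c S = (if b then 1 else 0)" if S: "S \<in> nsets Y 2" for S
    proof -
      obtain x y where xy: "x \<in> Y" "y \<in> Y" "x \<noteq> y" "S = {x, y}"
        using S by (auto simp: nsets_def card_2_iff)
      have "(c S = 1) = b"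
        using b xy by (cases x y rule: linorder_cases) (auto simp: insert_commute)
      moreover have "S \<in> nsets X 2" using S Y by (auto simp: nsets_def)
      then have "c S \<in> {0, 1}" using c by blast
      ultimately show ?thesis by auto
    qed
    then show "\<exists>Y. Y \<subseteq> X \<and> Y \<notin> I \<and> c constant_on nsets Y 2"
      using Y unfolding constant_on_def by blast
  qed
qed

lemma not_ordinary_ramsey_iff_homog:
  "\<not> ordinary_ramsey_property I \<longleftrightarrow> (\<exists>P. \<forall>Y. homog P Y \<longrightarrow> Y \<in> I)"
  unfolding ordinary_ramsey_property_def ramsey_at_iff_homog by auto

text \<open>The strict lexicographic order, pulled back along the map that sends \<open>x\<close> to
  the point \<open>\<lambda>n. x \<in> A n\<close> of the Cantor space.\<close>

definition lex_below :: "(nat \<Rightarrow> nat set) \<Rightarrow> nat \<Rightarrow> nat \<Rightarrow> bool" where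
  "lex_below A x y \<longleftrightarrow> (\<exists>n. (\<forall>i<n. x \<in> A i \<longleftrightarrow> y \<in> A i) \<and> x \<notin> A n \<and> y \<in> A n)"

lemma lex_below_asym: "lex_below A x y \<Longrightarrow> \<not> lex_below A y x"
  unfolding lex_below_def by (metis linorder_neqE_nat)

text \<open>
  Sierpinski's colouring: a homogeneous set is a lexicographically monotone sequence of points
  of the Cantor space, hence converges there.
\<close>

lemma homog_lex_below_imp_unsplit:
  assumes "homog (lex_below A) Y"
  shows "finite (Y \<inter> A n) \<or> finite (Y - A n)"
proof -
  obtain b where "\<forall>x\<in>Y. \<forall>y\<in>Y. x < y \<longrightarrow> lex_below A x y = b"
    using assms unfolding homog_def ..
  then have b: "lex_below A x y = b" if "x \<in> Y" "y \<in> Y" "x < y" for x y using that by simp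
  have "\<exists>k. \<forall>i<n. \<forall>x\<in>Y. \<forall>y\<in>Y. k \<le> x \<longrightarrow> k \<le> y \<longrightarrow> (x \<in> A i \<longleftrightarrow> y \<in> A i)" for n
  proof (induction n)
    case 0
    then show ?case by simp
  next
    case (Suc n)
    then obtain k where k: "\<And>i x y. i < n \<Longrightarrow> x \<in> Y \<Longrightarrow> y \<in> Y \<Longrightarrow> k \<le> x \<Longrightarrow> k \<le> y \<Longrightarrow>
        x \<in> A i \<longleftrightarrow> y \<in> A i" by blast
    have below: "lex_below A x y" if "x \<in> Y" "y \<in> Y" "k \<le> x" "k \<le> y" "x \<notin> A n" "y \<in> A n" for x y
      unfolding lex_below_def using k that by blast
    show ?case
    \<comment> \<open>Beyond \<open>k\<close>, membership in \<open>A n\<close> can only change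
      towards \<open>b\<close>, so once it agrees with \<open>b\<close> it is settled.\<close>
    proof (cases "\<exists>z\<in>Y. k \<le> z \<and> (z \<in> A n \<longleftrightarrow> b)")
      case True
      then obtain z where z: "z \<in> Y" "k \<le> z" "z \<in> A n \<longleftrightarrow> b" by blast
      have "y \<in> A n \<longleftrightarrow> b" if "y \<in> Y" "z \<le> y" for y
      proof (rule ccontr)
        assume ne: "(y \<in> A n) \<noteq> b"
        then have "z < y" using that z by (metis nat_less_le)
        then have "lex_below A z y = b" using b z that by blast
        moreover have "lex_below A y z" if b
          using below[of y z] z ne that \<open>y \<in> Y\<close> \<open>z \<le> y\<close> by auto
        moreover have "lex_below A z y" if "\<not> b"
          using below[of z y] z ne that \<open>y \<in> Y\<close> \<open>z \<le> y\<close> by auto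
        ultimately show False using lex_below_asym by blast
      qed
      then have "\<forall>i<Suc n. \<forall>x\<in>Y. \<forall>y\<in>Y. z \<le> x \<longrightarrow> z \<le> y \<longrightarrow> (x \<in> A i \<longleftrightarrow> y \<in> A i)"
        using k z(2) by (metis le_trans less_Suc_eq)
      then show ?thesis by blast
    next
      case False
      then have "\<forall>i<Suc n. \<forall>x\<in>Y. \<forall>y\<in>Y. k \<le> x \<longrightarrow> k \<le> y \<longrightarrow> (x \<in> A i \<longleftrightarrow> y \<in> A i)"
        using k by (metis less_Suc_eq)
      then show ?thesis by blast
    qed
  qed
  from this[of "Suc n"] obtain k where
    k: "\<And>x y. x \<in> Y \<Longrightarrow> y \<in> Y \<Longrightarrow> k \<le> x \<Longrightarrow> k \<le> y \<Longrightarrow> x \<in> A n \<longleftrightarrow> y \<in> A n" by blast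
  show ?thesis
  proof (cases "\<exists>x\<in>Y. k \<le> x \<and> x \<in> A n")
    case True
    then obtain x where "x \<in> Y" "k \<le> x" "x \<in> A n" by blast
    then have "y \<in> A n" if "y \<in> Y" "k \<le> y" for y using k[of x y] that by simp
    then have "Y - A n \<subseteq> {..<k}" by (auto simp flip: not_le)
    then show ?thesis using finite_subset by blast
  next
    case False
    then have "Y \<inter> A n \<subseteq> {..<k}" by (auto simp flip: not_le)
    then show ?thesis using finite_subset by blast
  qed
qed

lemma ramsey_property_unsplit:
  fixes A :: "nat \<Rightarrow> nat set"
  assumes "ramsey_property J" "X \<notin> J"
  shows "\<exists>Y\<subseteq>X. Y \<notin> J \<and> (\<forall>n. finite (Y \<inter> A n) \<or> finite (Y - A n))"
  using assms homog_lex_below_imp_unsplit[of A]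
  unfolding ramsey_property_def ramsey_at_iff_homog by meson

section \<open>Countable intersections\<close>

lemma not_ramsey_Inter:
  assumes F: "countable F" "F \<noteq> {}"
    and I: "\<And>I. I \<in> F \<Longrightarrow> omega_ideal I" "\<And>I. I \<in> F \<Longrightarrow> \<not> ordinary_ramsey_property I"
  shows "\<not> ramsey_property (\<Inter>F)"
proof
  assume R: "ramsey_property (\<Inter>F)"
  define I where "I = from_nat_into F"
  have rI: "range I = F" using F by (simp add: I_def range_from_nat_into)
  have ideal: "omega_ideal (I n)" for n using I(1) rI by blast
  have "\<exists>P. \<forall>Y. homog P Y \<longrightarrow> Y \<in> I n" for n
    using I(2)[of "I n"] rI by (auto simp: not_ordinary_ramsey_iff_homog)
  then obtain P where P: "\<And>n Y. homog (P n) Y \<Longrightarrow> Y \<in> I n" by metis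
  have fin: "Y \<in> \<Inter>F" if "finite Y" for Y
    using that I(1) by (auto simp: omega_ideal_def)
  have "UNIV \<notin> I 0" using ideal by (simp add: omega_ideal_def)
  then have UNIV: "UNIV \<notin> \<Inter>F" using rI by blast
  \<comment> \<open>All rows \<open>{y. P n x y}\<close> form one sequence, so on a single positive
    \<open>Y\<close> the limit of \<open>P n x y\<close> in \<open>y\<close> exists for all
    \<open>n\<close> and \<open>x\<close>. Below, \<open>x \<in> G n\<close> says that this limit is
    true, and \<open>i n\<close> is the limit of these limits along \<open>Z\<close>.\<close>
  define A where "A m = (case prod_decode m of (n, x) \<Rightarrow> Collect (P n x))" for m
  obtain Y where Y: "Y \<notin> \<Inter>F" and YA: "\<forall>m. finite (Y \<inter> A m) \<or> finite (Y - A m)"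
    using ramsey_property_unsplit[OF R UNIV, of A] by blast
  have unsplit: "finite (Y \<inter> Collect (P n x)) \<or> finite (Y - Collect (P n x))" for n x
    using YA[rule_format, of "prod_encode (n, x)"] by (simp add: A_def)
  define G where "G n = {x. finite (Y - Collect (P n x))}" for n
  obtain Z where Z: "Z \<subseteq> Y" "Z \<notin> \<Inter>F" and GZ: "\<forall>n. finite (Z \<inter> G n) \<or> finite (Z - G n)"
    using ramsey_property_unsplit[OF R Y, of G] by blast
  define i where "i n \<longleftrightarrow> finite (Z - G n)" for n
  define Bad where "Bad n = {x\<in>Z. (x \<in> G n) \<noteq> i n}" for n
  have finBad: "finite (Bad n)" for n
  proof (cases "i n")
    case True
    then have "Bad n = Z - G n" by (auto simp: Bad_def)
    then show ?thesis using True by (simp add: i_def)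
  next
    case False
    then have "Bad n = Z \<inter> G n" by (auto simp: Bad_def)
    then show ?thesis using False GZ i_def by metis
  qed
  have fin_ne: "finite {y\<in>Z. P n x y \<noteq> i n}" if "x \<in> Z" "x \<notin> Bad n" for n x
  proof (cases "i n")
    case True
    then have "finite (Y - Collect (P n x))" using that by (auto simp: Bad_def G_def)
    then show ?thesis by (rule rev_finite_subset) (use Z True in auto)
  next
    case False
    then have "finite (Y \<inter> Collect (P n x))" using that unsplit by (auto simp: Bad_def G_def)
    then show ?thesis by (rule rev_finite_subset) (use Z False in auto)
  qed
  \<comment> \<open>The bound \<open>n \<le> x\<close> leaves finitely many conditions for each
    \<open>x\<close>, so almost every \<open>y\<close> in \<open>Z\<close> meets them all; yet each
    \<open>n\<close> is tested by all but finitely many \<open>x\<close>.\<close>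
  define Q where "Q x y \<longleftrightarrow> (\<forall>n\<le>x. x \<in> Bad n \<or> P n x y = i n)" for x y
  obtain W where W: "W \<subseteq> Z" "W \<notin> \<Inter>F" "homog Q W"
    using R Z(2) unfolding ramsey_property_def ramsey_at_iff_homog by blast
  obtain b where "\<forall>x\<in>W. \<forall>y\<in>W. x < y \<longrightarrow> Q x y = b"
    using W(3) unfolding homog_def ..
  then have b: "Q x y = b" if "x \<in> W" "y \<in> W" "x < y" for x y using that by simp
  have b
  proof (rule ccontr)
    assume "\<not> b"
    obtain x where x: "x \<in> W" using W(2) fin by (metis equals0I finite.emptyI)
    have "W \<subseteq> {..x} \<union> (\<Union>n\<in>{n. n \<le> x \<and> x \<notin> Bad n}. {y\<in>Z. P n x y \<noteq> i n})"
    proof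
      fix y assume y: "y \<in> W"
      show "y \<in> {..x} \<union> (\<Union>n\<in>{n. n \<le> x \<and> x \<notin> Bad n}. {y\<in>Z. P n x y \<noteq> i n})"
        using b[OF x y] \<open>\<not> b\<close> y W by (cases "y \<le> x") (auto simp: Q_def)
    qed
    moreover have "finite ({..x} \<union> (\<Union>n\<in>{n. n \<le> x \<and> x \<notin> Bad n}. {y\<in>Z. P n x y \<noteq> i n}))"
      using fin_ne x W by auto
    ultimately show False using W(2) fin finite_subset by blast
  qed
  have "W \<in> I n" for n
  proof -
    have "P n x y = i n"
      if "x \<in> W - (Bad n \<union> {..<n})" "y \<in> W - (Bad n \<union> {..<n})" "x < y" for x y
    proof -
      have "Q x y" using b[of x y] \<open>b\<close> that by simp
      from this[unfolded Q_def, rule_format, of n] show ?thesis using that by auto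
    qed
    then have "homog (P n) (W - (Bad n \<union> {..<n}))"
      unfolding homog_def by (intro exI[of _ "i n"]) simp
    then have "W - (Bad n \<union> {..<n}) \<in> I n" by (rule P)
    moreover have "Bad n \<union> {..<n} \<in> I n"
      using ideal finBad unfolding omega_ideal_def by simp
    ultimately have "(W - (Bad n \<union> {..<n})) \<union> (Bad n \<union> {..<n}) \<in> I n"
      by (rule omega_ideal_Un[OF ideal])
    then show ?thesis by (rule omega_ideal_subset[OF ideal]) blast
  qed
  then show False using W(2) rI by blast
qed

section \<open>Topologically represented ideals\<close>

text \<open>No ball of the base splits a homogeneous set, so the closure of its image adds at most
  one new point. The closure is thus countable and compact, a countable union of singletons.\<close>

lemma topologically_represented_not_ordinary_ramsey:
  assumes J: "omega_ideal J" "topologically_represented J"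
  shows "\<not> ordinary_ramsey_property J"
proof -
  obtain K :: "real metric" and D e \<K> where rep: "represents K D e \<K> J"
    using J(2) unfolding topologically_represented_def by blast
  let ?T = "mtopology_of K"
  interpret Metric_space "mspace K" "mdist K" by (rule Metric_space_mspace_mdist)
  have T: "?T = mtopology" by (simp add: mtopology_of_def)
  have De: "D = range e" and eK: "e n \<in> mspace K"
    and dense: "mtopology closure_of D = mspace K" for n
    using rep by (auto simp: represents_def bij_betw_def T)
  define A where "A m = (case prod_decode m of (i, j) \<Rightarrow>
    {n. e n \<in> mball (e i) (inverse (Suc j))})" for m
  have "Y \<in> J" if Y: "homog (lex_below A) Y" for Y
  proof -
    have unsplit: "finite {n\<in>Y. e n \<in> mball (e i) (inverse (Suc j))}
      \<or> finite {n\<in>Y. e n \<notin> mball (e i) (inverse (Suc j))}" for i j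
      using homog_lex_below_imp_unsplit[OF Y, of "prod_encode (i, j)"]
      by (simp add: A_def Int_def set_diff_eq)
    define L where "L = mtopology closure_of (e ` Y)"
    have LK: "L \<subseteq> mspace K" using closure_of_subset_topspace[of mtopology] by (simp add: L_def)
    have inf: "infinite {n\<in>Y. e n \<in> mball z r}" if z: "z \<in> L - e ` Y" and "r > 0" for z r
    proof
      assume fin: "finite {n\<in>Y. e n \<in> mball z r}"
      have zK: "z \<in> mspace K" using z LK by blast
      define S where "S = e ` {n\<in>Y. e n \<in> mball z r}"
      have "closedin mtopology S"
        using fin eK by (auto simp: S_def intro!: closedin_Hausdorff_finite Hausdorff_space_mtopology)
      \<comment> \<open>As \<open>z\<close> is outside the image of \<open>Y\<close>, deleting
        finitely many points of that image leaves a neighbourhood of \<open>z\<close>, which must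
        meet the image again.\<close>
      then have "openin mtopology (mball z r - S)" by (simp add: openin_diff)
      moreover have "z \<in> mball z r - S" using z zK \<open>r > 0\<close> by (auto simp: S_def)
      moreover have "z \<in> mtopology closure_of (e ` Y)" using z by (simp add: L_def)
      then have "\<forall>U. z \<in> U \<and> openin mtopology U \<longrightarrow> (\<exists>y. y \<in> e ` Y \<and> y \<in> U)"
        unfolding in_closure_of by (rule conjunct2)
      note this[THEN spec, of "mball z r - S"]
      ultimately have "\<exists>y. y \<in> e ` Y \<and> y \<in> mball z r - S"
        using \<open>r > 0\<close> by simp
      then show False by (auto simp: S_def)
    qed
    have unique: "z = w" if z: "z \<in> L - e ` Y" and w: "w \<in> L - e ` Y" for z w
    proof (rule ccontr)
      assume "z \<noteq> w"
      have zK: "z \<in> mspace K" and wK: "w \<in> mspace K" using z w LK by auto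
      then have pos: "mdist K z w > 0" using \<open>z \<noteq> w\<close> by simp
      \<comment> \<open>With \<open>3 * r\<close> below the distance, an \<open>r\<close>-ball whose
        centre \<open>e i\<close> is \<open>r\<close>-close to \<open>z\<close> misses the
        \<open>r\<close>-ball about \<open>w\<close>, and hence splits \<open>Y\<close>.\<close>
      obtain j where "inverse (real (Suc j)) < mdist K z w / 3"
        using pos reals_Archimedean[of "mdist K z w / 3"] by auto
      define r where "r = inverse (real (Suc j))"
      have r: "r > 0" "3 * r < mdist K z w" using \<open>inverse (real (Suc j)) < _\<close> by (auto simp: r_def)
      have "z \<in> mtopology closure_of D" using dense zK by simp
      then obtain i where i: "e i \<in> mball z r"
        unfolding metric_closure_of De using r by blast
      then have zi: "z \<in> mball (e i) r" by (simp add: commute)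
      then obtain s where s: "s > 0" "mball z s \<subseteq> mball (e i) r"
        using openin_mball[of "e i" r] unfolding openin_mtopology by blast
      have "infinite {n\<in>Y. e n \<in> mball (e i) r}"
        using inf[OF z s(1)] by (rule infinite_super[rotated]) (use s in auto)
      moreover have "infinite {n\<in>Y. e n \<notin> mball (e i) r}"
      proof (rule infinite_super[OF _ inf[OF w r(1)]], safe)
        fix n assume "e n \<in> mball w r" "e n \<in> mball (e i) r"
        then have "mdist K z w < 3 * r"
          using triangle[of z "e i" w] triangle[of "e i" "e n" w] i
          by (simp add: commute)
        then show False using r by simp
      qed
      ultimately show False using unsplit[of i j] by (simp add: r_def)
    qed
    have singleton: "\<forall>x\<in>topspace ?T. {x} \<in> \<K>"
      and subset: "\<forall>C\<in>\<K>. \<forall>C'. compactin ?T C' \<and> C' \<subseteq> C \<longrightarrow> C' \<in> \<K>"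
      and Union: "\<forall>C :: nat \<Rightarrow> real set. (\<forall>n. C n \<in> \<K>) \<and> compactin ?T (\<Union>n. C n) \<longrightarrow> (\<Union>n. C n) \<in> \<K>"
      and "compact_space ?T"
      using rep unfolding represents_def sigma_ideal_of_compacts_def by - (elim conjE, assumption)+
    then have comp: "compactin ?T L" by (simp add: L_def T closedin_compact_space)
    have "L \<in> \<K>"
    proof (cases "L = {}")
      case True
      \<comment> \<open>The empty set has no enumeration, so it enters \<open>\<K>\<close> as a
        compact subset of a singleton.\<close>
      have "{e 0} \<in> \<K>" using singleton eK by simp
      then show ?thesis using subset[rule_format, of "{e 0}" L] comp True by simp
    next
      case False
      obtain z where "L - e ` Y \<subseteq> {z}" using unique by blast
      then have "L \<subseteq> insert z (range e)" by blast
      then have "countable L" by (rule countable_subset) simp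
      then obtain h :: "nat \<Rightarrow> real" where h: "range h = L"
        using range_from_nat_into[OF False] by blast
      then have "h n \<in> mspace K" for n using LK by blast
      then have "\<forall>n. {h n} \<in> \<K>" using singleton by simp
      moreover have Lh: "(\<Union>n. {h n}) = L" using h by auto
      ultimately show ?thesis using Union[THEN spec, of "\<lambda>n. {h n}"] comp by simp
    qed
    then show ?thesis using rep by (simp add: represents_def L_def T)
  qed
  then show ?thesis unfolding not_ordinary_ramsey_iff_homog by blast
qed

section \<open>Tall analytic P-ideals\<close>

text \<open>
  The positions won by the second player in the following game. In each round the first player
  adds an entry to the list \<open>s\<close> and forbids a finite set, and the second player then adds to
  \<open>E\<close> a point that is not forbidden. The first player wins if the infinite sequence that extends
  all the lists \<open>s\<close> is a code under \<open>g\<close> for a superset of all the sets \<open>E\<close>.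
\<close>

inductive second_wins :: "((nat \<Rightarrow> nat) \<Rightarrow> nat \<Rightarrow> bool) \<Rightarrow> nat list \<Rightarrow> nat set \<Rightarrow> bool"
  for g where
  stuck: "(\<And>b. map b [0..<length s] = s \<Longrightarrow> \<exists>x\<in>E. \<not> g b x) \<Longrightarrow> second_wins g s E"
| move: "(\<And>a. infinite (M a)) \<Longrightarrow>
    (\<And>a x. x \<in> M a \<Longrightarrow> second_wins g (s @ [a]) (insert x E)) \<Longrightarrow> second_wins g s E"

text \<open>
  The family \<open>\<B>\<close> collects, for every position of a winning strategy, an infinite set of replies
  that lies in the ideal. A code for a set that almost contains all of them defeats the strategy.
\<close>

lemma second_wins_countable_family:
  assumes "tall I" "second_wins g s E"
  shows "\<exists>\<B>\<subseteq>I. countable \<B> \<and>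
    (\<forall>b. (\<forall>B\<in>\<B>. finite (B - Collect (g b))) \<longrightarrow> map b [0..<length s] = s \<longrightarrow>
      \<not> E \<subseteq> Collect (g b))"
  using assms(2)
proof induction
  case (stuck s E)
  then show ?case by (intro exI[of _ "{}"]) auto
next
  case (move M s E)
  have "\<exists>B\<subseteq>M a. infinite B \<and> B \<in> I" for a
    using assms(1) move.hyps(1) unfolding tall_def by blast
  then obtain B where B: "\<And>a. B a \<subseteq> M a" "\<And>a. infinite (B a)" "\<And>a. B a \<in> I" by metis
  define beats where "beats \<C> a x \<longleftrightarrow> \<C> \<subseteq> I \<and> countable \<C> \<and>
    (\<forall>b. (\<forall>B\<in>\<C>. finite (B - Collect (g b))) \<longrightarrow> map b [0..<length (s @ [a])] = s @ [a] \<longrightarrow>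
      \<not> insert x E \<subseteq> Collect (g b))" for \<C> a x
  have "\<exists>\<C>. beats \<C> a x" if "x \<in> M a" for a x
    using move.IH[OF that] unfolding beats_def .
  moreover define \<B> where "\<B> a x = (SOME \<C>. beats \<C> a x)" for a x
  ultimately have beats: "beats (\<B> a x) a x" if "x \<in> M a" for a x
    using that by (metis someI_ex)
  have \<B>: "\<And>a x. x \<in> M a \<Longrightarrow> \<B> a x \<subseteq> I" "\<And>a x. x \<in> M a \<Longrightarrow> countable (\<B> a x)"
    "\<And>a x b. x \<in> M a \<Longrightarrow> \<forall>B\<in>\<B> a x. finite (B - Collect (g b)) \<Longrightarrow>
       map b [0..<length (s @ [a])] = s @ [a] \<Longrightarrow> \<not> insert x E \<subseteq> Collect (g b)"
    using beats unfolding beats_def by blast+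
  show ?case
  proof (intro exI[of _ "range B \<union> (\<Union>a. \<Union>x\<in>M a. \<B> a x)"] conjI allI impI)
    show "range B \<union> (\<Union>a. \<Union>x\<in>M a. \<B> a x) \<subseteq> I" using B(3) \<B>(1) by blast
    show "countable (range B \<union> (\<Union>a. \<Union>x\<in>M a. \<B> a x))" using \<B>(2) by auto
    fix b
    assume b: "\<forall>B\<in>range B \<union> (\<Union>a. \<Union>x\<in>M a. \<B> a x). finite (B - Collect (g b))"
      and s: "map b [0..<length s] = s"
    define a where "a = b (length s)"
    \<comment> \<open>\<open>B a\<close> is infinite and almost contained in
      \<open>Collect (g b)\<close>, so some allowed reply \<open>x\<close> lies in both; the
      induction hypothesis applies after it.\<close>
    have "\<not> B a \<subseteq> B a - Collect (g b)" using b B(2)[of a] finite_subset by blast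
    then obtain x where x: "x \<in> M a" "g b x" using B(1) by blast
    moreover have "map b [0..<length (s @ [a])] = s @ [a]" using s by (simp add: a_def)
    ultimately have "\<not> insert x E \<subseteq> Collect (g b)" using \<B>(3)[of x a b] b by blast
    then show "\<not> E \<subseteq> Collect (g b)" using x(2) by blast
  qed
qed

text \<open>Some member of the P-ideal almost contains every set of the countable family, and a code
  for it would defeat the winning strategy.\<close>

lemma not_second_wins_start:
  assumes "tall I" "p_ideal I" and g: "(\<lambda>A n. n \<in> A) ` I = range g"
  shows "\<not> second_wins g [] {}"
proof
  assume start: "second_wins g [] {}"
  obtain \<B> where \<B>: "\<B> \<subseteq> I" "countable \<B>" and
    win: "\<forall>b. (\<forall>B\<in>\<B>. finite (B - Collect (g b))) \<longrightarrow> map b [0..<length ([] :: nat list)] = [] \<longrightarrow>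
      \<not> {} \<subseteq> Collect (g b)"
    using second_wins_countable_family[OF assms(1) start] by (elim exE conjE) (rule that)
  \<comment> \<open>For an empty family, \<open>win\<close> would deny that the empty set is a
    subset.\<close>
  have "\<B> \<noteq> {}" using win by auto
  then obtain A :: "nat \<Rightarrow> nat set" where A: "range A = \<B>"
    using \<B>(2) by (metis range_from_nat_into)
  then have "\<forall>n. A n \<in> I" using \<B>(1) by blast
  then obtain C where C: "C \<in> I" "\<And>n. finite (A n - C)"
    using assms(2) unfolding p_ideal_def by blast
  have "(\<lambda>n. n \<in> C) \<in> range g" using C(1) unfolding g[symmetric] by (rule imageI)
  then obtain b where "(\<lambda>n. n \<in> C) = g b" by blast
  then have "C = Collect (g b)" by (metis Collect_mem_eq)
  then show False using win C(2) A by auto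
qed

text \<open>The replies of the second player are listed with the latest one first.\<close>

primrec first_moves :: "(nat list \<Rightarrow> nat set \<Rightarrow> nat) \<Rightarrow> nat list \<Rightarrow> nat list" where
  "first_moves \<sigma> [] = []"
| "first_moves \<sigma> (x # h) = first_moves \<sigma> h @ [\<sigma> (first_moves \<sigma> h) (set h)]"

text \<open>Where the second player has not won, \<open>move\<close> yields an entry after which
  only finitely many replies win; forbidding these gives the strategy \<open>\<sigma>\<close>. A
  homogeneous set is, up to finitely many points, a play against \<open>\<sigma>\<close>, and the
  entries of \<open>\<sigma>\<close> form a code for a superset of it.\<close>

lemma tall_analytic_p_ideal_not_ordinary_ramsey:
  assumes I: "tall I" "p_ideal I" "analytic_family I"
  shows "\<not> ordinary_ramsey_property I"
proof -
  have ideal: "omega_ideal I" using I(2) by (simp add: p_ideal_def)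
  then have fin: "Y \<in> I" if "finite Y" for Y using that by (simp add: omega_ideal_def)
  then have "I \<noteq> {}" by blast
  then obtain g :: "(nat \<Rightarrow> nat) \<Rightarrow> nat \<Rightarrow> bool"
    where cont: "continuous_on UNIV g" and g: "(\<lambda>A n. n \<in> A) ` I = range g"
    using I(3) unfolding analytic_family_def analytic_set_def by auto
  have "\<exists>a. finite {x. second_wins g (s @ [a]) (insert x E)}" if "\<not> second_wins g s E" for s E
    using second_wins.move[of "\<lambda>a. {x. second_wins g (s @ [a]) (insert x E)}"] that by blast
  then obtain \<sigma> where \<sigma>: "\<And>s E. \<not> second_wins g s E \<Longrightarrow>
      finite {x. second_wins g (s @ [\<sigma> s E]) (insert x E)}" by metis
  define st where "st = first_moves \<sigma>"
  define lost where "lost h \<longleftrightarrow> second_wins g (st h) (set h)" for h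
  have finlost: "finite {x. lost (x # h)}" if "\<not> lost h" for h
    using \<sigma> that by (simp add: lost_def st_def)
  have start: "\<not> lost []"
    using not_second_wins_start[OF I(1,2) g] by (simp add: lost_def st_def)
  \<comment> \<open>Distinctness makes these positions finite in number, so for fixed
    \<open>x\<close> almost every \<open>y\<close> satisfies \<open>P x y\<close>.\<close>
  define safe where "safe x = {h. set h \<subseteq> {..x} \<and> distinct h \<and> \<not> lost h}" for x
  have finsafe: "finite (safe x)" for x
    by (rule finite_subset[OF _ finite_subset_distinct[of "{..x}"]]) (auto simp: safe_def)
  define P where "P x y \<longleftrightarrow> (\<forall>h\<in>safe x. \<not> lost (y # h))" for x y
  have "Y \<in> I" if Y: "homog P Y" for Y
  proof (cases "finite Y")
    case False
    obtain b where "\<forall>x\<in>Y. \<forall>y\<in>Y. x < y \<longrightarrow> P x y = b"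
      using Y unfolding homog_def ..
    then have b: "P x y = b" if "x \<in> Y" "y \<in> Y" "x < y" for x y using that by simp
    have b
    proof (rule ccontr)
      assume "\<not> b"
      obtain x where x: "x \<in> Y" using False by fastforce
      have "Y \<subseteq> {..x} \<union> (\<Union>h\<in>safe x. {y. lost (y # h)})"
        using b[OF x] \<open>\<not> b\<close> by (force simp: P_def)
      moreover have "finite ({..x} \<union> (\<Union>h\<in>safe x. {y. lost (y # h)}))"
        using finsafe finlost by (auto simp: safe_def)
      ultimately show False using False finite_subset by blast
    qed
    \<comment> \<open>\<open>P\<close> does not restrict the least element of \<open>Y\<close>, so
      every losing first reply is removed.\<close>
    define Z where "Z = Y - {y. lost [y]}"
    have infZ: "infinite Z" using False finlost[OF start] by (simp add: Z_def)
    define e where "e = enumerate Z"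
    have e: "range e = Z" "\<And>j k. e j < e k \<longleftrightarrow> j < k"
      using infZ by (auto simp: e_def range_enumerate strict_mono_enumerate strict_mono_less)
    define h where "h k = rev (map e [0..<k])" for k
    have hSuc: "h (Suc k) = e k # h k" for k by (simp add: h_def)
    have seth: "set (h k) = e ` {..<k}" for k by (auto simp: h_def)
    have disth: "distinct (h k)" for k
      by (auto simp: h_def distinct_map inj_on_def) (metis e(2) linorder_neqE_nat nat_neq_iff)
    have "\<not> lost (h k)" for k
    proof (induction k)
      case 0
      then show ?case using start by (simp add: h_def)
    next
      case (Suc k)
      show ?case
      proof (cases k)
        case 0
        then show ?thesis using e(1) by (auto simp: h_def Z_def)
      next
        case k: (Suc j)
        have "e j \<in> Y" "e k \<in> Y" "e j < e k" using e k by (auto simp: Z_def)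
        then have "P (e j) (e k)" using b \<open>b\<close> by blast
        \<comment> \<open>The replies before \<open>e k\<close> are increasing, with
          \<open>e j\<close> the last of them.\<close>
        moreover have "h k \<in> safe (e j)"
          using Suc disth e(2) by (fastforce simp: safe_def seth k less_Suc_eq_le not_less[symmetric])
        ultimately show ?thesis by (simp add: P_def hSuc)
      qed
    qed
    then have nw: "\<not> second_wins g (st (h k)) (set (h k))" for k by (simp add: lost_def)
    define \<beta> where "\<beta> k = \<sigma> (st (h k)) (set (h k))" for k
    have st: "st (h k) = map \<beta> [0..<k]" for k
      by (induction k) (simp_all add: hSuc \<beta>_def st_def, simp add: h_def)
    \<comment> \<open>No position of the play is \<open>stuck\<close>, so some code agrees with
      \<open>\<beta>\<close> on \<open>k\<close> entries and covers the first \<open>k\<close>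
      replies. These codes converge to \<open>\<beta>\<close>, and continuity of \<open>g\<close>
      carries the covering over.\<close>
    have "\<exists>c. map c [0..<k] = map \<beta> [0..<k] \<and> (\<forall>x\<in>set (h k). g c x)" for k
      using second_wins.stuck[of "st (h k)" "set (h k)" g] nw[of k] by (auto simp: st)
    then obtain c where c: "\<And>k. map (c k) [0..<k] = map \<beta> [0..<k]"
      "\<And>k x. x \<in> set (h k) \<Longrightarrow> g (c k) x" by metis
    have "c k i = \<beta> i" if "i < k" for i k
      using arg_cong[OF c(1)[of k], of "\<lambda>l. l ! i"] that by simp
    then have "\<forall>\<^sub>F k in sequentially. c k i = \<beta> i" for i
      by (auto simp: eventually_sequentially intro!: exI[of _ "Suc i"])
    then have "c \<longlonglongrightarrow> \<beta>"
      unfolding limitin_canonical_iff[symmetric] euclidean_product_topology[symmetric]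
      by (simp add: limitin_componentwise tendsto_discrete)
    then have "(\<lambda>k. g (c k)) \<longlonglongrightarrow> g \<beta>"
      using cont continuous_on_tendsto_compose by fastforce
    then have lim: "(\<lambda>k. g (c k) x) \<longlonglongrightarrow> g \<beta> x" for x
      unfolding limitin_canonical_iff[symmetric] euclidean_product_topology[symmetric]
      by (simp add: limitin_componentwise)
    have "g \<beta> x" if x: "x \<in> Z" for x
    proof -
      obtain j where j: "x = e j" using x e(1) by blast
      have "\<forall>\<^sub>F k in sequentially. g (c k) x = g \<beta> x"
        using lim[of x] by (simp add: tendsto_discrete)
      moreover have "\<forall>\<^sub>F k in sequentially. g (c k) x"
        using c(2) by (auto simp: j seth eventually_sequentially intro!: exI[of _ "Suc j"])
      ultimately have "\<forall>\<^sub>F k in sequentially. g \<beta> x" by eventually_elim simp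
      then show ?thesis by simp
    qed
    moreover have "Collect (g \<beta>) \<in> I"
    proof -
      have "g \<beta> \<in> (\<lambda>A n. n \<in> A) ` I" unfolding g by simp
      then show ?thesis by auto
    qed
    ultimately have "Z \<in> I"
      using omega_ideal_subset[OF ideal] by (metis mem_Collect_eq subsetI)
    then have "Z \<union> {y. lost [y]} \<in> I"
      using fin[OF finlost[OF start]] by (rule omega_ideal_Un[OF ideal])
    moreover have "Y \<subseteq> Z \<union> {y. lost [y]}" by (auto simp: Z_def)
    ultimately show ?thesis by (rule omega_ideal_subset[OF ideal])
  qed (rule fin)
  then show ?thesis unfolding not_ordinary_ramsey_iff_homog by blast
qed

theorem theoremB:
  shows "(\<forall>F. countable F \<and> F \<noteq> {} \<and>
            (\<forall>I\<in>F. tall I \<and> analytic_family I \<and> p_ideal I) \<longrightarrow>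
            \<not> ramsey_property (\<Inter>F)) \<and>
         (\<forall>F. countable F \<and> F \<noteq> {} \<and>
            (\<forall>I\<in>F. omega_ideal I \<and> \<not> ordinary_ramsey_property I) \<longrightarrow>
            \<not> ramsey_property (\<Inter>F)) \<and>
         (\<forall>F. countable F \<and> F \<noteq> {} \<and>
            (\<forall>J\<in>F. omega_ideal J \<and> topologically_represented J) \<longrightarrow>
            \<not> ramsey_property (\<Inter>F))"
proof (intro conjI allI impI; elim conjE)
  fix F :: "nat set set set"
  assume F: "countable F" "F \<noteq> {}" and "\<forall>I\<in>F. tall I \<and> analytic_family I \<and> p_ideal I"
  then show "\<not> ramsey_property (\<Inter>F)"
    using not_ramsey_Inter[OF F] tall_analytic_p_ideal_not_ordinary_ramsey
    unfolding p_ideal_def by blast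
next
  fix F :: "nat set set set"
  assume F: "countable F" "F \<noteq> {}"
    and "\<forall>I\<in>F. omega_ideal I \<and> \<not> ordinary_ramsey_property I"
  then show "\<not> ramsey_property (\<Inter>F)"
    using not_ramsey_Inter[OF F] by blast
next
  fix F :: "nat set set set"
  assume F: "countable F" "F \<noteq> {}"
    and "\<forall>J\<in>F. omega_ideal J \<and> topologically_represented J"
  then show "\<not> ramsey_property (\<Inter>F)"
    using not_ramsey_Inter[OF F] topologically_represented_not_ordinary_ramsey by blast
qed

end
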